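(* Let $X,Y$ be metric spaces, $L\ge1$, $\varepsilon\ge0$, $\delta\ge0$, and let $f\colon X\to Y$ be an $(L,\varepsilon,\delta)$-quasi-isometry. Put $\varphi_f(t)=Lt+\varepsilon$ and $\vartheta_f(t)=Lt+L(\varepsilon+2\delta)$. Then, for every $(L,\varepsilon,\delta)$-stable element $c\in H_p(\mathrm{Rips}(X,s))$, the image $f_*(c)\in H_p(\mathrm{Rips}(Y,\varphi_f(s)))$ satisfies $$\sup\mathrm{spt}(f_*(c))\in[\vartheta_f^{-1}(\sup\mathrm{spt}(c)),\ \varphi_f(\sup\mathrm{spt}(c))]$$ and $$\inf\mathrm{spt}(f_*(c))\in[\vartheta_f^{-1}(\inf\overline{\mathrm{spt}}(c)),\ \varphi_f(\inf\mathrm{spt}(c))].$$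
   Context: Quasi-isometries. $f\colon (X,d_X)\to(Y,d_Y)$ is an $(L,\varepsilon)$-quasi-isometric embedding if $\frac1L d_X(x_1,x_2)-\varepsilon\le d_Y(f(x_1),f(x_2))\le L d_X(x_1,x_2)+\varepsilon$ for all $x_1,x_2\in X$; it is an $(L,\varepsilon,\delta)$-quasi-isometry if moreover the Hausdorff distance between $f(X)$ and $Y$ in $Y$ is at most $\delta$. Rips homology. For a metric space $X$, a $p$-simplex is any map $\{0,\dots,p\}\to X$, written $[x_0,\dots,x_p]$ (repetitions allowed). $\mathrm{Rips}_p(X,s)$ is the $\mathbb Z_2$-vector space with basis the $p$-simplices with $\mathrm{diam}\{x_0,\dots,x_p\}\le s$ (it is $0$ for $s<0$ or $p<0$), with boundary $\partial_p[x_0,\dots,x_p]=\sum_i(-1)^i[x_0,\dots,x_{i-1},x_{i+1},\dots,x_p]$. $H_p(\mathrm{Rips}(X,s))=\ker\partial_p/\mathrm{im}\,\partial_{p+1}$, and for $s\le t$, $\phi_X^{t,s}\colon H_p(\mathrm{Rips}(X,s))\to H_p(\mathrm{Rips}(X,t))$ is induced by inclusion. Induced map. For $s\ge0$, $f_*\colon H_p(\mathrm{Rips}(X,s))\to H_p(\mathrm{Rips}(Y,Ls+\varepsilon))$ is induced by the chain map $[x_0,\dots,x_p]\mapsto[f(x_0),\dots,f(x_p)]$. Supports. For a nonzero $c\in H_p(\mathrm{Rips}(X,s))$, the persistence support is $\mathrm{spt}(c)=\{t\ge0\colon t\le s,\ c\in\mathrm{im}(\phi_X^{s,t})\}\cup\{t\ge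 s\colon\phi_X^{t,s}(c)\ne0\}$, and the total persistence support is $\overline{\mathrm{spt}}(c)=\bigcup\{\mathrm{spt}(\phi_X^{t,s}(c))\colon t\ge s,\ \phi_X^{t,s}(c)\ne0\}$. Suprema may be $+\infty$, with $\varphi_f(\infty)=\vartheta_f^{-1}(\infty)=\infty$. Stability. Let $\lambda_{(L,\varepsilon,\delta)}(s)=L^2s+2L(\varepsilon+\delta)$. A nonzero class $c\in H_p(\mathrm{Rips}(X,s))$ is $(L,\varepsilon,\delta)$-stable if $\lambda_{(L,\varepsilon,\delta)}(s)<\sup\mathrm{spt}(c)$ (for such $c$ one has $f_*(c)\ne0$, so $\mathrm{spt}(f_*(c))$ is defined). *)

theory Defs
  imports "HOL-Analysis.Analysis" "HOL-Algebra.Coset" "HOL-Library.Poly_Mapping" "HOL-Library.Z2"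
begin

section \<open>Quasi-isometries\<close>

text \<open>Extended values are used so that an unbounded set is at infinite distance; over
  \<^typ>\<open>ennreal\<close> the supremum of the empty set is 0 and the infimum of the empty set is infinite.\<close>

definition hausdorff_distance :: "'a::metric_space set \<Rightarrow> 'a set \<Rightarrow> ennreal" where
  "hausdorff_distance A B =
     max (SUP a\<in>A. INF b\<in>B. ennreal (dist a b)) (SUP b\<in>B. INF a\<in>A. ennreal (dist a b))"

definition quasi_isometric_embedding ::
    "real \<Rightarrow> real \<Rightarrow> ('a::metric_space \<Rightarrow> 'b::metric_space) \<Rightarrow> bool" where
  "quasi_isometric_embedding L \<epsilon> f \<longleftrightarrow>
     (\<forall>x1 x2. (1 / L) * dist x1 x2 - \<epsilon> \<le> dist (f x1) (f x2) \<and>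
              dist (f x1) (f x2) \<le> L * dist x1 x2 + \<epsilon>)"

definition quasi_isometry ::
    "real \<Rightarrow> real \<Rightarrow> real \<Rightarrow> ('a::metric_space \<Rightarrow> 'b::metric_space) \<Rightarrow> bool" where
  "quasi_isometry L \<epsilon> \<delta> f \<longleftrightarrow>
     quasi_isometric_embedding L \<epsilon> f \<and> hausdorff_distance (range f) UNIV \<le> ennreal \<delta>"

definition qi_phi :: "real \<Rightarrow> real \<Rightarrow> real \<Rightarrow> real" where
  "qi_phi L \<epsilon> t = L * t + \<epsilon>"

definition qi_theta :: "real \<Rightarrow> real \<Rightarrow> real \<Rightarrow> real \<Rightarrow> real" where
  "qi_theta L \<epsilon> \<delta> t = L * t + L * (\<epsilon> + 2 * \<delta>)"

definition qi_lambda :: "real \<Rightarrow> real \<Rightarrow> real \<Rightarrow> real \<Rightarrow> real" where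
  "qi_lambda L \<epsilon> \<delta> s = L\<^sup>2 * s + 2 * L * (\<epsilon> + \<delta>)"

text \<open>Extension of a real function by fixing the infinite values.\<close>

definition extend_ereal :: "(real \<Rightarrow> real) \<Rightarrow> ereal \<Rightarrow> ereal" where
  "extend_ereal g x = (if \<bar>x\<bar> = \<infinity> then x else ereal (g (real_of_ereal x)))"


section \<open>Rips homology with coefficients in the field with two elements\<close>

text \<open>The simplex \<open>[x\<^sub>0, \<dots>, x\<^sub>p]\<close> is the list of its vertices, so it has length \<open>p + 1\<close>.
  Excluding the empty list makes the chain spaces zero for \<open>p = -1\<close> as well; as diameters are
  nonnegative, they are also zero for \<open>s < 0\<close>.\<close>

definition rips_simplices :: "int \<Rightarrow> real \<Rightarrow> 'a::metric_space list set" where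
  "rips_simplices p s = {\<sigma>. \<sigma> \<noteq> [] \<and> int (length \<sigma>) = p + 1 \<and> diameter (set \<sigma>) \<le> s}"

definition rips_chains :: "int \<Rightarrow> real \<Rightarrow> ('a::metric_space list \<Rightarrow>\<^sub>0 bit) set" where
  "rips_chains p s = {c. Poly_Mapping.keys c \<subseteq> rips_simplices p s}"

definition simplex_face :: "nat \<Rightarrow> 'a list \<Rightarrow> 'a list" where
  "simplex_face i \<sigma> = take i \<sigma> @ drop (Suc i) \<sigma>"

text \<open>The case distinction is needed for \<open>p = 0\<close>: the face of a vertex is the empty list, while
  the chain space in degree \<open>-1\<close> is zero (the homology is not reduced).\<close>

definition rips_boundary :: "int \<Rightarrow> ('a list \<Rightarrow>\<^sub>0 bit) \<Rightarrow> ('a list \<Rightarrow>\<^sub>0 bit)" where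
  "rips_boundary p c =
     (if p \<le> 0 then 0
      else \<Sum>\<sigma>\<in>Poly_Mapping.keys c. \<Sum>i<length \<sigma>.
             Poly_Mapping.single (simplex_face i \<sigma>) ((-1) ^ i * Poly_Mapping.lookup c \<sigma>))"

text \<open>Cycles form an abelian group of exponent 2, which determines the vector space structure
  over the two-element field.  Homology is the quotient group, so its elements are cosets of the
  group of boundaries.\<close>

definition rips_cycle_group :: "int \<Rightarrow> real \<Rightarrow> ('a::metric_space list \<Rightarrow>\<^sub>0 bit) monoid" where
  "rips_cycle_group p s =
     \<lparr>carrier = {c \<in> rips_chains p s. rips_boundary p c = 0}, monoid.mult = (+), one = 0\<rparr>"

definition rips_boundaries :: "int \<Rightarrow> real \<Rightarrow> ('a::metric_space list \<Rightarrow>\<^sub>0 bit) set" where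
  "rips_boundaries p s = rips_boundary (p + 1) ` rips_chains (p + 1) s"

definition rips_homology :: "int \<Rightarrow> real \<Rightarrow> ('a::metric_space list \<Rightarrow>\<^sub>0 bit) set monoid" where
  "rips_homology p s = rips_cycle_group p s Mod rips_boundaries p s"

text \<open>The map into homology at scale \<open>t\<close> induced by a chain map \<open>h\<close>.  The union ranges over all
  representatives \<open>z\<close> of the class \<open>c\<close>, which all yield the same coset, namely that of \<open>h z\<close>.
  The source scale is not an argument, since \<open>c\<close> contains its representatives.\<close>

definition rips_induced ::
    "int \<Rightarrow> real \<Rightarrow> (('a list \<Rightarrow>\<^sub>0 bit) \<Rightarrow> ('b::metric_space list \<Rightarrow>\<^sub>0 bit)) \<Rightarrow>
     ('a list \<Rightarrow>\<^sub>0 bit) set \<Rightarrow> ('b list \<Rightarrow>\<^sub>0 bit) set" where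
  "rips_induced p t h c = (\<Union>z\<in>c. rips_boundaries p t #>\<^bsub>rips_cycle_group p t\<^esub> h z)"

text \<open>\<open>rips_transition p t s\<close> is the map \<open>\<phi>\<^sup>t\<^sup>,\<^sup>s\<close> from scale \<open>s\<close> to scale \<open>t\<close>; it is only
  used for \<open>s \<le> t\<close>.  The argument \<open>s\<close> is kept to match this notation.\<close>

definition rips_transition ::
    "int \<Rightarrow> real \<Rightarrow> real \<Rightarrow> ('a::metric_space list \<Rightarrow>\<^sub>0 bit) set \<Rightarrow> ('a list \<Rightarrow>\<^sub>0 bit) set" where
  "rips_transition p t s = rips_induced p t (\<lambda>z. z)"

definition chain_pushforward :: "('a \<Rightarrow> 'b) \<Rightarrow> ('a list \<Rightarrow>\<^sub>0 bit) \<Rightarrow> ('b list \<Rightarrow>\<^sub>0 bit)" where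
  "chain_pushforward f c =
     (\<Sum>\<sigma>\<in>Poly_Mapping.keys c. Poly_Mapping.single (map f \<sigma>) (Poly_Mapping.lookup c \<sigma>))"

definition rips_pushforward ::
    "real \<Rightarrow> real \<Rightarrow> int \<Rightarrow> real \<Rightarrow> ('a::metric_space \<Rightarrow> 'b::metric_space) \<Rightarrow>
     ('a list \<Rightarrow>\<^sub>0 bit) set \<Rightarrow> ('b list \<Rightarrow>\<^sub>0 bit) set" where
  "rips_pushforward L \<epsilon> p s f = rips_induced p (qi_phi L \<epsilon> s) (chain_pushforward f)"


section \<open>Persistence supports and stability\<close>

text \<open>These are meaningful for a nonzero class \<open>c\<close> in degree \<open>p\<close> at scale \<open>s\<close>.\<close>

definition spt :: "int \<Rightarrow> real \<Rightarrow> ('a::metric_space list \<Rightarrow>\<^sub>0 bit) set \<Rightarrow> real set" where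
  "spt p s c =
     {t. 0 \<le> t \<and> t \<le> s \<and> c \<in> rips_transition p s t ` carrier (rips_homology p t)} \<union>
     {t. s \<le> t \<and> rips_transition p t s c \<noteq> \<one>\<^bsub>rips_homology p t\<^esub>}"

definition total_spt :: "int \<Rightarrow> real \<Rightarrow> ('a::metric_space list \<Rightarrow>\<^sub>0 bit) set \<Rightarrow> real set" where
  "total_spt p s c =
     (\<Union>t\<in>{t. s \<le> t \<and> rips_transition p t s c \<noteq> \<one>\<^bsub>rips_homology p t\<^esub>}.
        spt p t (rips_transition p t s c))"

definition sup_ereal :: "real set \<Rightarrow> ereal" where
  "sup_ereal A = (SUP t\<in>A. ereal t)"

definition inf_ereal :: "real set \<Rightarrow> ereal" where
  "inf_ereal A = (INF t\<in>A. ereal t)"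

definition qi_stable ::
    "real \<Rightarrow> real \<Rightarrow> real \<Rightarrow> int \<Rightarrow> real \<Rightarrow> ('a::metric_space list \<Rightarrow>\<^sub>0 bit) set \<Rightarrow> bool" where
  "qi_stable L \<epsilon> \<delta> p s c \<longleftrightarrow>
     c \<in> carrier (rips_homology p s) \<and> c \<noteq> \<one>\<^bsub>rips_homology p s\<^esub> \<and>
     ereal (qi_lambda L \<epsilon> \<delta> s) < sup_ereal (spt p s c)"

end

theory Submission
  imports Defs
begin

text \<open>
  A point of \<open>Y\<close> need not have a nearest point in \<open>f(X)\<close>, but for each \<open>\<delta>' > \<delta>\<close> one can choose
  \<open>g : Y \<rightarrow> X\<close> with \<open>d(f(g y), y) \<le> \<delta>'\<close>.  The lower estimate for \<open>f\<close> shows that \<open>g\<close> sends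
  simplices of diameter at most \<open>t\<close> to simplices of diameter at most
  \<open>\<vartheta>'(t) = L t + L (\<epsilon> + 2 \<delta>')\<close>, and that \<open>g \<circ> f\<close> moves points by at most \<open>L (\<epsilon> + \<delta>')\<close>.  Hence a
  simplex of diameter at most \<open>s\<close> and its image under \<open>g \<circ> f\<close> together have diameter at most
  \<open>\<lambda>'(s) = \<vartheta>'(\<phi>(s)) = L\<^sup>2 s + 2 L (\<epsilon> + \<delta>')\<close>, and the prism operator shows that \<open>g\<^sub>* f\<^sub>*\<close> is the
  transition map from scale \<open>s\<close> to scale \<open>\<lambda>'(s)\<close> (\<open>quasi_inverse_pushforward_homologous\<close>).

  All four estimates follow by chasing classes through \<open>f\<^sub>*\<close> and \<open>g\<^sub>*\<close>.

  \<^item> A class that is zero at scale \<open>u\<close> has image zero at scale \<open>\<phi>(u)\<close>, and a class that comes from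
    scale \<open>u\<close> has an image that comes from scale \<open>\<phi>(u)\<close>.  This bounds the support of \<open>f\<^sub>* c\<close> from
    above (\<open>spt_pushforward_below_phi\<close>, \<open>phi_below_spt_pushforward\<close>).

  \<^item> If \<open>f\<^sub>* c\<close> were zero at a scale \<open>r \<ge> \<phi>(s)\<close>, then applying \<open>g\<^sub>*\<close> would make \<open>c\<close> zero at scale
    \<open>\<vartheta>'(r)\<close> (\<open>pushforward_survives\<close>).  This is the lower bound for the supremum, and it also shows
    that \<open>f\<^sub>* c\<close> is nonzero.

  \<^item> If \<open>f\<^sub>* c\<close> comes from scale \<open>t\<close>, then the image of \<open>c\<close> at scale \<open>\<lambda>'(s)\<close>, which is \<open>g\<^sub>* f\<^sub>* c\<close>,
    comes from scale \<open>\<vartheta>'(t)\<close> (\<open>total_spt_below_theta\<close>).  The class \<open>c\<close> itself need not come from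
    there, which is why the total support appears in the lower bound for the infimum.

  Stability provides a scale beyond \<open>\<lambda>(s)\<close> at which \<open>c\<close> is still nonzero; since that inequality is
  strict, \<open>c\<close> is nonzero at \<open>\<lambda>'(s)\<close> for all \<open>\<delta>'\<close> close to \<open>\<delta>\<close>, and letting \<open>\<delta>' \<rightarrow> \<delta>\<close> gives the
  stated bounds.
\<close>

section \<open>Linear extension over the two-element field\<close>

lemma bit_chain_add_self [simp]: "(c :: 'a \<Rightarrow>\<^sub>0 bit) + c = 0"
  by (rule poly_mapping_eqI) (simp add: lookup_add)

lemma bit_chain_add_left_cancel [simp]: "(a :: 'a \<Rightarrow>\<^sub>0 bit) + (a + b) = b"
  by (simp flip: add.assoc)

lemma bit_chain_add_eq_iff: "(a :: 'a \<Rightarrow>\<^sub>0 bit) + b = c \<longleftrightarrow> a = c + b"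
  by (auto simp: add.assoc)

lemma lookup_eq_1_if_key: "\<sigma> \<in> Poly_Mapping.keys (c :: 'a \<Rightarrow>\<^sub>0 bit) \<Longrightarrow> Poly_Mapping.lookup c \<sigma> = 1"
  by (metis bit_not_one_iff in_keys_iff)

lemma keys_bit_add:
  "Poly_Mapping.keys ((a :: 'a \<Rightarrow>\<^sub>0 bit) + b) =
     (Poly_Mapping.keys a - Poly_Mapping.keys b) \<union> (Poly_Mapping.keys b - Poly_Mapping.keys a)"
  by (auto simp: in_keys_iff lookup_add bit_not_zero_iff)

abbreviation basis_chain :: "'a list \<Rightarrow> ('a list \<Rightarrow>\<^sub>0 bit)" where
  "basis_chain \<sigma> \<equiv> Poly_Mapping.single \<sigma> 1"

text \<open>A chain over the two-element field is determined by its set of keys, so extending a map of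
  basis elements linearly amounts to summing it over the keys.\<close>

definition linear_extension :: "('a \<Rightarrow> ('b \<Rightarrow>\<^sub>0 bit)) \<Rightarrow> ('a \<Rightarrow>\<^sub>0 bit) \<Rightarrow> ('b \<Rightarrow>\<^sub>0 bit)" where
  "linear_extension F c = (\<Sum>\<sigma>\<in>Poly_Mapping.keys c. F \<sigma>)"

lemma linear_extension_zero [simp]: "linear_extension F 0 = 0"
  by (simp add: linear_extension_def)

lemma linear_extension_single [simp]: "linear_extension F (Poly_Mapping.single \<sigma> 1) = F \<sigma>"
  by (simp add: linear_extension_def)

lemma linear_extension_add:
  "linear_extension F (a + b) = linear_extension F a + linear_extension F b"
proof -
  let ?A = "Poly_Mapping.keys a" and ?B = "Poly_Mapping.keys b"
  have "linear_extension F (a + b) = sum F (?A - ?B) + sum F (?B - ?A)"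
    unfolding linear_extension_def keys_bit_add by (rule sum.union_disjoint) auto
  moreover have "sum F ?A = sum F (?A - ?B) + sum F (?A \<inter> ?B)"
    by (metis add.commute finite_keys sum.Int_Diff)
  moreover have "sum F ?B = sum F (?B - ?A) + sum F (?A \<inter> ?B)"
    by (metis add.commute finite_keys sum.Int_Diff Int_commute)
  ultimately show ?thesis
    by (simp add: linear_extension_def ac_simps)
qed

lemma linear_extension_sum: "linear_extension F (sum g A) = (\<Sum>i\<in>A. linear_extension F (g i))"
  by (induction A rule: infinite_finite_induct) (simp_all add: linear_extension_add)

lemma linear_extension_comp:
  "linear_extension F (linear_extension G c) = linear_extension (\<lambda>\<sigma>. linear_extension F (G \<sigma>)) c"
  by (simp add: linear_extension_def [of G] linear_extension_def [of "\<lambda>\<sigma>. linear_extension F (G \<sigma>)"]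
                linear_extension_sum)

lemma linear_extension_add_fun:
  "linear_extension (\<lambda>\<sigma>. F \<sigma> + G \<sigma>) c = linear_extension F c + linear_extension G c"
  by (simp add: linear_extension_def sum.distrib)

lemma keys_linear_extension:
  "Poly_Mapping.keys (linear_extension F c) \<subseteq> (\<Union>\<sigma>\<in>Poly_Mapping.keys c. Poly_Mapping.keys (F \<sigma>))"
  unfolding linear_extension_def by (rule keys_sum)

lemma linear_extension_basis_chain: "linear_extension basis_chain c = c"
proof (rule poly_mapping_eqI)
  fix \<tau>
  show "Poly_Mapping.lookup (linear_extension basis_chain c) \<tau> = Poly_Mapping.lookup c \<tau>"
    using lookup_eq_1_if_key [of \<tau> c]
    by (cases "\<tau> \<in> Poly_Mapping.keys c")
       (auto simp: linear_extension_def lookup_sum lookup_single when_def in_keys_iff sum.delta)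
qed


section \<open>The boundary operator and the prism operator\<close>

abbreviation cons_chain :: "'a \<Rightarrow> ('a list \<Rightarrow>\<^sub>0 bit) \<Rightarrow> ('a list \<Rightarrow>\<^sub>0 bit)" where
  "cons_chain x \<equiv> linear_extension (\<lambda>\<sigma>. basis_chain (x # \<sigma>))"

text \<open>The boundary of the augmented complex, in which the empty list is a simplex of degree \<open>-1\<close>.
  With the augmentation, adding a vertex in front of a simplex is a cone construction without an
  exceptional case, so that identities between chain maps can be proved by induction on lists.\<close>

fun augmented_boundary :: "'a list \<Rightarrow> ('a list \<Rightarrow>\<^sub>0 bit)" where
  "augmented_boundary [] = 0"
| "augmented_boundary (x # \<sigma>) = basis_chain \<sigma> + cons_chain x (augmented_boundary \<sigma>)"

lemma augmented_boundary_eq_sum_faces: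
  "augmented_boundary \<sigma> = (\<Sum>i<length \<sigma>. basis_chain (simplex_face i \<sigma>))"
proof (induction \<sigma>)
  case (Cons x \<sigma>)
  have "(\<Sum>i<length (x # \<sigma>). basis_chain (simplex_face i (x # \<sigma>)))
        = basis_chain \<sigma> + (\<Sum>i<length \<sigma>. basis_chain (x # simplex_face i \<sigma>))"
    by (simp add: sum.lessThan_Suc_shift simplex_face_def del: sum.lessThan_Suc)
  then show ?case
    by (simp add: Cons.IH linear_extension_sum)
qed simp

lemma rips_boundary_eq_linear_extension:
  "rips_boundary p c = (if p \<le> 0 then 0 else linear_extension augmented_boundary c)"
proof -
  have "(\<Sum>i<length \<sigma>. Poly_Mapping.single (simplex_face i \<sigma>) ((-1) ^ i * Poly_Mapping.lookup c \<sigma>))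
        = augmented_boundary \<sigma>" if "\<sigma> \<in> Poly_Mapping.keys c" for \<sigma>
    using that by (simp add: augmented_boundary_eq_sum_faces lookup_eq_1_if_key)
  then show ?thesis
    by (simp add: rips_boundary_def linear_extension_def)
qed

lemma chain_pushforward_eq_linear_extension:
  "chain_pushforward f = linear_extension (\<lambda>\<sigma>. basis_chain (map f \<sigma>))"
  by (auto simp: fun_eq_iff chain_pushforward_def linear_extension_def lookup_eq_1_if_key
           intro!: sum.cong)

lemma rips_boundary_zero [simp]: "rips_boundary p 0 = 0"
  by (simp add: rips_boundary_eq_linear_extension)

lemma rips_boundary_add: "rips_boundary p (a + b) = rips_boundary p a + rips_boundary p b"
  by (simp add: rips_boundary_eq_linear_extension linear_extension_add)

lemma chain_pushforward_zero [simp]: "chain_pushforward f 0 = 0"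
  by (simp add: chain_pushforward_eq_linear_extension)

lemma chain_pushforward_add:
  "chain_pushforward f (a + b) = chain_pushforward f a + chain_pushforward f b"
  by (simp add: chain_pushforward_eq_linear_extension linear_extension_add)

lemma chain_pushforward_comp:
  "chain_pushforward g (chain_pushforward f c) = chain_pushforward (g \<circ> f) c"
  by (simp add: chain_pushforward_eq_linear_extension linear_extension_comp)

lemma chain_pushforward_ident: "chain_pushforward (\<lambda>x. x) c = c"
  by (simp add: chain_pushforward_eq_linear_extension linear_extension_basis_chain)

lemma augmented_boundary_cons_chain:
  "linear_extension augmented_boundary (cons_chain x c)
     = c + cons_chain x (linear_extension augmented_boundary c)"
  by (simp add: linear_extension_comp linear_extension_add_fun linear_extension_basis_chain)

lemma chain_pushforward_cons_chain:
  "chain_pushforward f (cons_chain x c) = cons_chain (f x) (chain_pushforward f c)"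
  by (simp add: chain_pushforward_eq_linear_extension linear_extension_comp)

lemma augmented_boundary_map:
  "augmented_boundary (map f \<sigma>) = chain_pushforward f (augmented_boundary \<sigma>)"
proof (induction \<sigma>)
  case (Cons x \<sigma>)
  then show ?case
    by (simp add: chain_pushforward_add chain_pushforward_cons_chain)
       (simp add: chain_pushforward_eq_linear_extension)
qed simp

lemma rips_boundary_pushforward:
  "rips_boundary p (chain_pushforward f c) = chain_pushforward f (rips_boundary p c)"
proof -
  have "linear_extension augmented_boundary (chain_pushforward f c)
        = linear_extension (\<lambda>\<sigma>. augmented_boundary (map f \<sigma>)) c"
    by (simp add: chain_pushforward_eq_linear_extension linear_extension_comp)
  also have "\<dots> = chain_pushforward f (linear_extension augmented_boundary c)"
    by (simp add: augmented_boundary_map chain_pushforward_eq_linear_extension linear_extension_comp)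
  finally show ?thesis
    by (simp add: rips_boundary_eq_linear_extension)
qed

text \<open>For \<open>\<sigma> = [x\<^sub>0, \<dots>, x\<^sub>p]\<close> this is the triangulated prism
  \<open>\<Sum>\<^sub>i [f x\<^sub>0, \<dots>, f x\<^sub>i, g x\<^sub>i, \<dots>, g x\<^sub>p]\<close>, in recursive form.\<close>

fun prism :: "('a \<Rightarrow> 'b) \<Rightarrow> ('a \<Rightarrow> 'b) \<Rightarrow> 'a list \<Rightarrow> ('b list \<Rightarrow>\<^sub>0 bit)" where
  "prism f g [] = 0"
| "prism f g (x # \<sigma>) = basis_chain (f x # map g (x # \<sigma>)) + cons_chain (f x) (prism f g \<sigma>)"

lemma prism_cons_chain:
  "linear_extension (prism f g) (cons_chain x c)
     = cons_chain (f x) (cons_chain (g x) (chain_pushforward g c))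
       + cons_chain (f x) (linear_extension (prism f g) c)"
  by (simp add: chain_pushforward_eq_linear_extension linear_extension_comp linear_extension_add_fun)

text \<open>The boundary of the prism consists of its bottom, its top and the prism over the boundary.
  In the induction step the coned copies of the common terms occur twice and cancel.\<close>

lemma prism_boundary_simplex:
  "linear_extension augmented_boundary (prism f g \<sigma>)
     + linear_extension (prism f g) (augmented_boundary \<sigma>) = basis_chain (map f \<sigma>) + basis_chain (map g \<sigma>)"
proof (induction \<sigma>)
  case (Cons x \<sigma>)
  let ?D = "linear_extension augmented_boundary" and ?P = "linear_extension (prism f g)"
  let ?R = "cons_chain (f x) (cons_chain (g x) (chain_pushforward g (augmented_boundary \<sigma>)))"
  have "?D (prism f g (x # \<sigma>))
        = basis_chain (map g (x # \<sigma>)) + cons_chain (f x) (basis_chain (map g \<sigma>)) + ?R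
          + prism f g \<sigma> + cons_chain (f x) (?D (prism f g \<sigma>))"
    by (simp add: linear_extension_add augmented_boundary_cons_chain augmented_boundary_map
                  chain_pushforward_cons_chain add.assoc)
  moreover have "?P (augmented_boundary (x # \<sigma>))
        = prism f g \<sigma> + ?R + cons_chain (f x) (?P (augmented_boundary \<sigma>))"
    by (simp add: linear_extension_add prism_cons_chain add.assoc)
  ultimately have "?D (prism f g (x # \<sigma>)) + ?P (augmented_boundary (x # \<sigma>))
        = basis_chain (map g (x # \<sigma>)) + cons_chain (f x) (basis_chain (map g \<sigma>))
          + cons_chain (f x) (?D (prism f g \<sigma>) + ?P (augmented_boundary \<sigma>))"
    by (simp add: linear_extension_add ac_simps)
  also have "\<dots> = basis_chain (map f (x # \<sigma>)) + basis_chain (map g (x # \<sigma>))"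
    unfolding Cons.IH by (simp add: linear_extension_add ac_simps)
  finally show ?case .
qed simp

lemma prism_boundary:
  "linear_extension augmented_boundary (linear_extension (prism f g) c)
     + linear_extension (prism f g) (linear_extension augmented_boundary c)
     = chain_pushforward f c + chain_pushforward g c"
  by (simp add: linear_extension_comp chain_pushforward_eq_linear_extension prism_boundary_simplex
           flip: linear_extension_add_fun)

lemma keys_prism:
  "\<tau> \<in> Poly_Mapping.keys (prism f g \<sigma>) \<Longrightarrow>
     length \<tau> = Suc (length \<sigma>) \<and> set \<tau> \<subseteq> f ` set \<sigma> \<union> g ` set \<sigma>"
proof (induction \<sigma> arbitrary: \<tau>)
  case (Cons x \<sigma>)
  have "\<tau> = f x # map g (x # \<sigma>) \<or> (\<exists>\<rho>\<in>Poly_Mapping.keys (prism f g \<sigma>). \<tau> = f x # \<rho>)"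
    using Cons.prems keys_linear_extension [of "\<lambda>\<sigma>. basis_chain (f x # \<sigma>)" "prism f g \<sigma>"]
    by (auto simp: keys_bit_add)
  then show ?case
    using Cons.IH by fastforce
qed simp


section \<open>Rips chains\<close>

lemma diameter_set_le_iff:
  fixes \<sigma> :: "'a::metric_space list"
  assumes "\<sigma> \<noteq> []"
  shows "diameter (set \<sigma>) \<le> s \<longleftrightarrow> (\<forall>x\<in>set \<sigma>. \<forall>y\<in>set \<sigma>. dist x y \<le> s)"
proof
  assume "diameter (set \<sigma>) \<le> s"
  then show "\<forall>x\<in>set \<sigma>. \<forall>y\<in>set \<sigma>. dist x y \<le> s"
    using diameter_bounded_bound [of "set \<sigma>"] finite_imp_bounded [of "set \<sigma>"] by force
next
  assume "\<forall>x\<in>set \<sigma>. \<forall>y\<in>set \<sigma>. dist x y \<le> s"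
  then show "diameter (set \<sigma>) \<le> s"
    using assms by (auto simp: diameter_def intro!: cSUP_least)
qed

lemma mem_rips_simplices_iff:
  "\<sigma> \<in> rips_simplices p s \<longleftrightarrow>
     \<sigma> \<noteq> [] \<and> int (length \<sigma>) = p + 1 \<and> (\<forall>x\<in>set \<sigma>. \<forall>y\<in>set \<sigma>. dist x y \<le> s)"
  by (auto simp: rips_simplices_def diameter_set_le_iff)

lemma rips_simplices_mono: "s \<le> t \<Longrightarrow> rips_simplices p s \<subseteq> rips_simplices p t"
  by (auto simp: rips_simplices_def)

lemma rips_simplices_nonempty:
  assumes "\<sigma> \<in> rips_simplices p s"
  shows "0 \<le> p" and "0 \<le> s"
proof -
  have \<sigma>: "\<sigma> \<noteq> []" "int (length \<sigma>) = p + 1" "\<forall>x\<in>set \<sigma>. dist x x \<le> s"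
    using assms unfolding mem_rips_simplices_iff by blast+
  then show "0 \<le> p"
    by (cases \<sigma>) auto
  show "0 \<le> s"
    using \<sigma>(1,3) by (cases \<sigma>) auto
qed

lemma linear_extension_rips_chains:
  assumes "c \<in> rips_chains p s"
    and "\<And>\<sigma>. \<sigma> \<in> rips_simplices p s \<Longrightarrow> Poly_Mapping.keys (F \<sigma>) \<subseteq> rips_simplices q t"
  shows "linear_extension F c \<in> rips_chains q t"
  using assms keys_linear_extension [of F c] unfolding rips_chains_def by blast

lemma rips_chains_zero [simp]: "0 \<in> rips_chains p s"
  by (simp add: rips_chains_def)

lemma rips_chains_add: "a \<in> rips_chains p s \<Longrightarrow> b \<in> rips_chains p s \<Longrightarrow> a + b \<in> rips_chains p s"
  by (auto simp: rips_chains_def keys_bit_add)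

lemma rips_chains_mono: "s \<le> t \<Longrightarrow> rips_chains p s \<subseteq> rips_chains p t"
  using rips_simplices_mono by (fastforce simp: rips_chains_def)

lemma rips_chains_pushforward:
  assumes "\<And>x y. dist x y \<le> s \<Longrightarrow> dist (f x) (f y) \<le> t" and "c \<in> rips_chains p s"
  shows "chain_pushforward f c \<in> rips_chains p t"
  unfolding chain_pushforward_eq_linear_extension
  by (rule linear_extension_rips_chains [OF assms(2)])
     (use assms(1) in \<open>auto simp: mem_rips_simplices_iff\<close>)

abbreviation rips_cycles :: "int \<Rightarrow> real \<Rightarrow> ('a::metric_space list \<Rightarrow>\<^sub>0 bit) set" where
  "rips_cycles p s \<equiv> carrier (rips_cycle_group p s)"

lemma rips_cycles_eq: "rips_cycles p s = {c \<in> rips_chains p s. rips_boundary p c = 0}"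
  by (simp add: rips_cycle_group_def)

lemma rips_cycles_pushforward:
  assumes "\<And>x y. dist x y \<le> s \<Longrightarrow> dist (f x) (f y) \<le> t" and "z \<in> rips_cycles p s"
  shows "chain_pushforward f z \<in> rips_cycles p t"
  using assms by (auto simp: rips_cycles_eq rips_boundary_pushforward intro: rips_chains_pushforward)

lemma rips_boundaries_zero [simp]: "0 \<in> rips_boundaries p s"
  unfolding rips_boundaries_def by (rule image_eqI [of _ _ 0]) simp_all

lemma rips_boundaries_add:
  "a \<in> rips_boundaries p s \<Longrightarrow> b \<in> rips_boundaries p s \<Longrightarrow> a + b \<in> rips_boundaries p s"
  unfolding rips_boundaries_def
  by clarify (metis image_eqI rips_boundary_add rips_chains_add)

lemma rips_boundaries_add_cancel:
  assumes "a + b \<in> rips_boundaries p s"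
  shows "a \<in> rips_boundaries p s \<longleftrightarrow> b \<in> rips_boundaries p s"
  using assms rips_boundaries_add [of "a + b" p s]
  by (metis add.commute bit_chain_add_left_cancel)

lemma rips_boundaries_mono: "s \<le> t \<Longrightarrow> rips_boundaries p s \<subseteq> rips_boundaries p t"
  unfolding rips_boundaries_def by (intro image_mono rips_chains_mono)

lemma rips_boundaries_pushforward:
  assumes "\<And>x y. dist x y \<le> s \<Longrightarrow> dist (f x) (f y) \<le> t" and "b \<in> rips_boundaries p s"
  shows "chain_pushforward f b \<in> rips_boundaries p t"
proof -
  obtain a where "a \<in> rips_chains (p + 1) s" and "b = rips_boundary (p + 1) a"
    using assms(2) by (auto simp: rips_boundaries_def)
  then show ?thesis
    using rips_chains_pushforward [of s f t] assms(1)
    by (auto simp: rips_boundaries_def simp flip: rips_boundary_pushforward)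
qed

lemma rips_nonboundary_nonneg:
  assumes "z \<in> rips_cycles p s" and "z \<notin> rips_boundaries p s"
  shows "0 \<le> p" and "0 \<le> s"
proof -
  have "z \<noteq> 0"
    using assms(2) by auto
  then have "Poly_Mapping.keys z \<noteq> {}" and "Poly_Mapping.keys z \<subseteq> rips_simplices p s"
    using assms(1) by (auto simp: rips_cycles_eq rips_chains_def)
  then show "0 \<le> p" "0 \<le> s"
    using rips_simplices_nonempty by blast+
qed

text \<open>Two maps that are close relative to \<open>t\<close> send a cycle to homologous cycles, because all
  simplices of the prism over a simplex of diameter at most \<open>s\<close> have diameter at most \<open>t\<close>.\<close>

lemma prism_homotopy:
  fixes f g :: "'a::metric_space \<Rightarrow> 'b::metric_space"
  assumes p: "0 \<le> p" and z: "z \<in> rips_cycles p s"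
    and ff: "\<And>x y. dist x y \<le> s \<Longrightarrow> dist (f x) (f y) \<le> t"
    and gg: "\<And>x y. dist x y \<le> s \<Longrightarrow> dist (g x) (g y) \<le> t"
    and fg: "\<And>x y. dist x y \<le> s \<Longrightarrow> dist (f x) (g y) \<le> t"
  shows "chain_pushforward f z + chain_pushforward g z \<in> rips_boundaries p t"
proof -
  have zc: "z \<in> rips_chains p s" and zb: "rips_boundary p z = 0"
    using z by (auto simp: rips_cycles_eq)
  have "linear_extension (prism f g) z \<in> rips_chains (p + 1) t"
  proof (rule linear_extension_rips_chains [OF zc], rule subsetI)
    fix \<sigma> :: "'a list" and \<tau> :: "'b list"
    assume \<sigma>: "\<sigma> \<in> rips_simplices p s" and "\<tau> \<in> Poly_Mapping.keys (prism f g \<sigma>)"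
    then have len: "length \<tau> = Suc (length \<sigma>)" and sub: "set \<tau> \<subseteq> f ` set \<sigma> \<union> g ` set \<sigma>"
      using keys_prism by blast+
    have "dist u v \<le> t" if "u \<in> f ` set \<sigma> \<union> g ` set \<sigma>" "v \<in> f ` set \<sigma> \<union> g ` set \<sigma>" for u v
      using that \<sigma> ff gg fg by (auto simp: mem_rips_simplices_iff) (metis dist_commute)
    then show "\<tau> \<in> rips_simplices (p + 1) t"
      using len sub \<sigma> by (auto simp: mem_rips_simplices_iff subset_eq)
  qed
  moreover have "linear_extension (prism f g) (linear_extension augmented_boundary z) = 0"
  proof (cases "p = 0")
    case True
    \<comment> \<open>The augmented boundary of a vertex is the empty simplex, which has an empty prism.\<close>
    have "linear_extension (prism f g) (augmented_boundary \<sigma>) = 0" if "\<sigma> \<in> Poly_Mapping.keys z" for \<sigma>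
    proof -
      have "length \<sigma> = 1"
        using that zc True by (auto simp: rips_chains_def rips_simplices_def)
      then obtain x where "\<sigma> = [x]"
        by (auto simp: length_Suc_conv)
      then show ?thesis by simp
    qed
    then show ?thesis
      by (simp add: linear_extension_comp) (simp add: linear_extension_def)
  next
    case False
    then show ?thesis
      using p zb by (simp add: rips_boundary_eq_linear_extension)
  qed
  then have "rips_boundary (p + 1) (linear_extension (prism f g) z)
             = chain_pushforward f z + chain_pushforward g z"
    using p prism_boundary [of f g z] by (simp add: rips_boundary_eq_linear_extension)
  ultimately show ?thesis
    unfolding rips_boundaries_def by (metis image_eqI)
qed


section \<open>Homology classes and their supports\<close>

abbreviation rips_class :: "int \<Rightarrow> real \<Rightarrow> ('a::metric_space list \<Rightarrow>\<^sub>0 bit) \<Rightarrow> ('a list \<Rightarrow>\<^sub>0 bit) set" where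
  "rips_class p s z \<equiv> rips_boundaries p s #>\<^bsub>rips_cycle_group p s\<^esub> z"

text \<open>In characteristic two, subtraction is addition, so a coset is described by sums.\<close>

lemma mem_rips_class_iff: "w \<in> rips_class p s z \<longleftrightarrow> w + z \<in> rips_boundaries p s"
  by (auto simp: r_coset_def rips_cycle_group_def bit_chain_add_eq_iff add.assoc
           intro!: bexI [of _ "w + z"])

lemma rips_class_eq_iff: "rips_class p s z = rips_class p s w \<longleftrightarrow> z + w \<in> rips_boundaries p s"
proof
  assume "rips_class p s z = rips_class p s w"
  then show "z + w \<in> rips_boundaries p s"
    using mem_rips_class_iff [of z p s z] mem_rips_class_iff [of z p s w] by simp
next
  assume *: "z + w \<in> rips_boundaries p s"
  have "u + z \<in> rips_boundaries p s \<longleftrightarrow> u + w \<in> rips_boundaries p s" for u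
    by (rule rips_boundaries_add_cancel) (use * in \<open>simp add: ac_simps\<close>)
  then show "rips_class p s z = rips_class p s w"
    by (auto simp: mem_rips_class_iff)
qed

lemma one_rips_homology: "\<one>\<^bsub>rips_homology p s\<^esub> = rips_boundaries p s"
  by (simp add: rips_homology_def FactGroup_def)

lemma rips_class_zero: "rips_class p s 0 = rips_boundaries p s"
  by (auto simp: mem_rips_class_iff)

lemma rips_class_eq_one_iff:
  "rips_class p s z = \<one>\<^bsub>rips_homology p s\<^esub> \<longleftrightarrow> z \<in> rips_boundaries p s"
  using rips_class_eq_iff [of p s z 0] by (simp add: rips_class_zero one_rips_homology)

lemma carrier_rips_homology: "carrier (rips_homology p s) = rips_class p s ` rips_cycles p s"
  by (auto simp: rips_homology_def FactGroup_def RCOSETS_def)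

lemma rips_induced_class:
  assumes "\<And>a b. h (a + b) = h a + h b"
    and "\<And>b. b \<in> rips_boundaries p s \<Longrightarrow> h b \<in> rips_boundaries p t"
  shows "rips_induced p t h (rips_class p s z) = rips_class p t (h z)"
proof -
  have "rips_class p t (h w) = rips_class p t (h z)" if "w \<in> rips_class p s z" for w
    using that assms by (simp add: rips_class_eq_iff mem_rips_class_iff flip: assms(1))
  moreover have "z \<in> rips_class p s z"
    by (simp add: mem_rips_class_iff)
  ultimately show ?thesis
    unfolding rips_induced_def by blast
qed

lemma rips_transition_class:
  "s \<le> t \<Longrightarrow> rips_transition p t s (rips_class p s z) = rips_class p t z"
  unfolding rips_transition_def using rips_boundaries_mono by (intro rips_induced_class) auto

text \<open>Supports in terms of a representative.  After this reduction all arguments about supports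
  are about chains.\<close>

lemma mem_spt_class_iff:
  "t \<in> spt p s (rips_class p s z) \<longleftrightarrow>
     0 \<le> t \<and> t \<le> s \<and> (\<exists>y\<in>rips_cycles p t. y + z \<in> rips_boundaries p s) \<or>
     s \<le> t \<and> z \<notin> rips_boundaries p t"
proof -
  have "rips_class p s z \<in> rips_transition p s t ` carrier (rips_homology p t) \<longleftrightarrow>
        (\<exists>y\<in>rips_cycles p t. y + z \<in> rips_boundaries p s)" if "t \<le> s"
    using that
    by (auto simp: carrier_rips_homology image_image rips_transition_class image_iff
                   rips_class_eq_iff add.commute)
  moreover have "rips_transition p t s (rips_class p s z) \<noteq> \<one>\<^bsub>rips_homology p t\<^esub> \<longleftrightarrow>
        z \<notin> rips_boundaries p t" if "s \<le> t"
    using that by (simp add: rips_transition_class rips_class_eq_one_iff)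
  ultimately show ?thesis
    unfolding spt_def by auto
qed

lemma mem_total_spt_classI:
  assumes "s \<le> u" and "z \<notin> rips_boundaries p u" and "t \<in> spt p u (rips_class p u z)"
  shows "t \<in> total_spt p s (rips_class p s z)"
  using assms unfolding total_spt_def
  by (auto simp: rips_transition_class rips_class_eq_one_iff intro!: exI [of _ u])


section \<open>Quasi-isometries\<close>

text \<open>The Hausdorff distance is a supremum of infima that need not be attained, hence the strict
  inequality \<open>\<delta> < \<delta>'\<close>.\<close>

lemma quasi_isometry_quasi_inverse:
  fixes f :: "'a::metric_space \<Rightarrow> 'b::metric_space"
  assumes f: "quasi_isometry L \<epsilon> \<delta> f" and "0 \<le> \<delta>" and "\<delta> < \<delta>'"
  obtains g where "\<And>y. dist (f (g y)) y \<le> \<delta>'"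
proof -
  have "\<exists>x. dist (f x) y \<le> \<delta>'" for y
  proof -
    have "(INF a\<in>range f. ennreal (dist a y)) \<le> (SUP b. INF a\<in>range f. ennreal (dist a b))"
      by (rule SUP_upper) simp
    also have "\<dots> \<le> hausdorff_distance (range f) UNIV"
      by (simp add: hausdorff_distance_def)
    also have "\<dots> \<le> ennreal \<delta>"
      using f by (simp add: quasi_isometry_def)
    also have "\<dots> < ennreal \<delta>'"
      using assms by (simp add: ennreal_lessI)
    finally obtain x where "ennreal (dist (f x) y) < ennreal \<delta>'"
      by (auto simp: INF_less_iff)
    then show ?thesis
      using assms by (auto simp: ennreal_less_iff less_imp_le intro!: exI [of _ x])
  qed
  then show thesis
    using that by metis
qed

lemma quasi_isometry_dist:
  assumes "quasi_isometry L \<epsilon> \<delta> f" and "1 \<le> L"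
  shows quasi_isometry_dist_upper: "dist (f x) (f y) \<le> L * dist x y + \<epsilon>"
    and quasi_isometry_dist_lower: "dist x y \<le> L * (dist (f x) (f y) + \<epsilon>)"
proof -
  have *: "(1 / L) * dist x y - \<epsilon> \<le> dist (f x) (f y)" "dist (f x) (f y) \<le> L * dist x y + \<epsilon>"
    using assms by (auto simp: quasi_isometry_def quasi_isometric_embedding_def)
  then show "dist (f x) (f y) \<le> L * dist x y + \<epsilon>"
    by simp
  have "dist x y / L \<le> dist (f x) (f y) + \<epsilon>"
    using * by simp
  then show "dist x y \<le> L * (dist (f x) (f y) + \<epsilon>)"
    using assms(2) by (simp add: divide_le_eq mult.commute)
qed

lemma quasi_isometry_qi_phi:
  assumes "quasi_isometry L \<epsilon> \<delta> f" and "1 \<le> L" and "dist x y \<le> t"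
  shows "dist (f x) (f y) \<le> qi_phi L \<epsilon> t"
proof -
  have "L * dist x y \<le> L * t"
    using assms(2,3) by simp
  then show ?thesis
    using quasi_isometry_dist_upper [OF assms(1,2), of x y] by (simp add: qi_phi_def)
qed

lemma qi_theta_phi: "qi_theta L \<epsilon> \<delta> (qi_phi L \<epsilon> s) = qi_lambda L \<epsilon> \<delta> s"
  by (simp add: qi_theta_def qi_phi_def qi_lambda_def algebra_simps power2_eq_square)

lemma qi_lambda_ge:
  assumes "1 \<le> L" "0 \<le> \<epsilon>" "0 \<le> \<delta>" "0 \<le> s"
  shows "s + L * (\<epsilon> + \<delta>) \<le> qi_lambda L \<epsilon> \<delta> s"
proof -
  have "1 * s \<le> L\<^sup>2 * s"
    using assms by (intro mult_right_mono) auto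
  moreover have "0 \<le> L * (\<epsilon> + \<delta>)"
    using assms by simp
  ultimately show ?thesis
    by (simp add: qi_lambda_def)
qed

lemma quasi_inverse_dist:
  assumes f: "quasi_isometry L \<epsilon> \<delta> f" and L: "1 \<le> L"
    and g: "\<And>y. dist (f (g y)) y \<le> \<delta>'"
  shows "dist y y' \<le> t \<Longrightarrow> dist (g y) (g y') \<le> qi_theta L \<epsilon> \<delta>' t"
    and "dist x (g (f x)) \<le> L * (\<epsilon> + \<delta>')"
proof -
  assume "dist y y' \<le> t"
  have "dist (f (g y)) (f (g y')) \<le> dist (f (g y)) y + dist y y' + dist (f (g y')) y'"
    by (metis add_right_mono dist_commute dist_triangle dist_triangle_le order_trans add.commute)
  also have "\<dots> \<le> t + 2 * \<delta>'"
    using g [of y] g [of y'] \<open>dist y y' \<le> t\<close> by simp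
  finally have "L * (dist (f (g y)) (f (g y')) + \<epsilon>) \<le> L * (t + 2 * \<delta>' + \<epsilon>)"
    using L by simp
  then show "dist (g y) (g y') \<le> qi_theta L \<epsilon> \<delta>' t"
    using quasi_isometry_dist_lower [OF f L, of "g y" "g y'"]
    by (simp add: qi_theta_def algebra_simps)
next
  have "L * (dist (f x) (f (g (f x))) + \<epsilon>) \<le> L * (\<delta>' + \<epsilon>)"
    using L g [of "f x"] by (simp add: dist_commute)
  then show "dist x (g (f x)) \<le> L * (\<epsilon> + \<delta>')"
    using quasi_isometry_dist_lower [OF f L, of x "g (f x)"] by (simp add: add.commute)
qed

text \<open>The map \<open>g\<^sub>* f\<^sub>*\<close> is the transition from scale \<open>s\<close> to \<open>\<lambda>'(s)\<close>: the prism between the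
  identity and \<open>g \<circ> f\<close> has diameter at most \<open>\<lambda>'(s)\<close>.\<close>

lemma quasi_inverse_pushforward_homologous:
  assumes f: "quasi_isometry L \<epsilon> \<delta> f" and L: "1 \<le> L" and "0 \<le> \<epsilon>" and "0 \<le> \<delta>'"
    and g: "\<And>y. dist (f (g y)) y \<le> \<delta>'"
    and "0 \<le> p" and "0 \<le> s" and z: "z \<in> rips_cycles p s"
  shows "z + chain_pushforward g (chain_pushforward f z) \<in> rips_boundaries p (qi_lambda L \<epsilon> \<delta>' s)"
proof -
  let ?t = "qi_lambda L \<epsilon> \<delta>' s"
  have ge: "s + L * (\<epsilon> + \<delta>') \<le> ?t"
    using assms by (intro qi_lambda_ge)
  have gf: "dist x (g (f x)) \<le> L * (\<epsilon> + \<delta>')" for x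
    by (rule quasi_inverse_dist [OF f L g])
  have pos: "0 \<le> L * (\<epsilon> + \<delta>')"
    using assms by simp
  have "chain_pushforward (\<lambda>x. x) z + chain_pushforward (g \<circ> f) z \<in> rips_boundaries p ?t"
  proof (rule prism_homotopy [OF \<open>0 \<le> p\<close> z])
    fix x y :: 'a assume xy: "dist x y \<le> s"
    show "dist x y \<le> ?t"
      using xy ge pos by linarith
    show "dist x ((g \<circ> f) y) \<le> ?t"
      using dist_triangle [of x "g (f y)" y] xy ge gf [of y] by simp
    have "dist (f x) (f y) \<le> qi_phi L \<epsilon> s"
      by (rule quasi_isometry_qi_phi [OF f L xy])
    then show "dist ((g \<circ> f) x) ((g \<circ> f) y) \<le> ?t"
      using quasi_inverse_dist(1) [OF f L g] by (simp flip: qi_theta_phi)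
  qed
  then show ?thesis
    by (simp add: chain_pushforward_ident chain_pushforward_comp)
qed


section \<open>Extended real bounds\<close>

lemma extend_ereal_ereal [simp]: "extend_ereal g (ereal t) = ereal (g t)"
  by (simp add: extend_ereal_def)

lemma extend_ereal_mono:
  assumes "mono g" and "x \<le> y"
  shows "extend_ereal g x \<le> extend_ereal g y"
  using assms by (cases x; cases y) (auto simp: extend_ereal_def mono_def)

text \<open>This Galois connection removes inverse functions from all bounds, so that only the
  monotonicity of \<open>g\<close> is needed to pass to suprema and infima.\<close>

lemma extend_ereal_inv_le_iff:
  assumes "strict_mono g" and "bij g"
  shows "extend_ereal (inv_into UNIV g) x \<le> y \<longleftrightarrow> x \<le> extend_ereal g y"
proof -
  have "inv_into UNIV g a \<le> b \<longleftrightarrow> a \<le> g b" for a b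
    using assms by (metis bij_inv_eq_iff strict_mono_less_eq)
  then show ?thesis
    by (cases x; cases y) (auto simp: extend_ereal_def)
qed

lemma affine_strict_mono_bij:
  fixes a b :: real
  assumes "0 < a"
  shows "strict_mono (\<lambda>t. a * t + b)" and "bij (\<lambda>t. a * t + b)"
proof -
  show "strict_mono (\<lambda>t. a * t + b)"
    using assms by (simp add: strict_mono_def)
  show "bij (\<lambda>t. a * t + b)"
    by (rule o_bij [of "\<lambda>t. (t - b) / a"]) (use assms in \<open>auto simp: fun_eq_iff\<close>)
qed

text \<open>The slack \<open>\<eta>\<close> absorbs the difference between \<open>\<delta>'\<close> and \<open>\<delta>\<close>.\<close>

lemma sup_ereal_le_extend:
  assumes "mono g" and "\<And>t \<eta>. t \<in> A \<Longrightarrow> 0 < \<eta> \<Longrightarrow> \<exists>u\<in>B. t \<le> g u + \<eta>"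
  shows "sup_ereal A \<le> extend_ereal g (sup_ereal B)"
  unfolding sup_ereal_def [of A]
proof (rule SUP_least, rule ereal_le_epsilon2)
  fix t \<eta> :: real assume "t \<in> A" "0 < \<eta>"
  then obtain u where u: "u \<in> B" "t \<le> g u + \<eta>"
    using assms(2) by blast
  have "ereal u \<le> sup_ereal B"
    unfolding sup_ereal_def using u(1) by (rule SUP_upper)
  then have "ereal (g u) \<le> extend_ereal g (sup_ereal B)"
    using extend_ereal_mono [OF assms(1)] by fastforce
  moreover have "ereal t \<le> ereal (g u) + ereal \<eta>"
    using u(2) by simp
  ultimately show "ereal t \<le> extend_ereal g (sup_ereal B) + ereal \<eta>"
    by (meson add_right_mono order_trans)
qed

lemma inv_extend_inf_ereal_le:
  assumes "strict_mono g" and "bij g"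
    and "\<And>t \<eta>. t \<in> A \<Longrightarrow> 0 < \<eta> \<Longrightarrow> \<exists>u\<in>B. u \<le> g t + \<eta>"
  shows "extend_ereal (inv_into UNIV g) (inf_ereal B) \<le> inf_ereal A"
  unfolding inf_ereal_def [of A]
proof (rule INF_greatest)
  fix t assume "t \<in> A"
  have "inf_ereal B \<le> ereal (g t)"
  proof (rule ereal_le_epsilon2)
    fix \<eta> :: real assume "0 < \<eta>"
    then obtain u where u: "u \<in> B" "u \<le> g t + \<eta>"
      using assms(3) \<open>t \<in> A\<close> by blast
    have "inf_ereal B \<le> ereal u"
      unfolding inf_ereal_def using u(1) by (rule INF_lower)
    with u(2) show "inf_ereal B \<le> ereal (g t) + ereal \<eta>"
      by (simp add: order_trans)
  qed
  then show "extend_ereal (inv_into UNIV g) (inf_ereal B) \<le> ereal t"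
    by (simp add: extend_ereal_inv_le_iff [OF assms(1,2)])
qed


section \<open>Supports under a quasi-isometry\<close>

text \<open>If \<open>f\<^sub>* c\<close> survives to \<open>t = \<phi>(u)\<close> with \<open>u \<ge> s\<close>, then \<open>c\<close> survives to \<open>u\<close>.  Scales
  \<open>t \<le> \<phi>(s)\<close> are covered by \<open>s\<close>, which lies in the support of a nonzero class.\<close>

lemma spt_pushforward_below_phi:
  fixes f :: "'a::metric_space \<Rightarrow> 'b::metric_space"
  assumes f: "quasi_isometry L \<epsilon> \<delta> f" and L: "1 \<le> L"
    and z: "z \<notin> rips_boundaries p s"
    and t: "t \<in> spt p (qi_phi L \<epsilon> s) (rips_class p (qi_phi L \<epsilon> s) (chain_pushforward f z))"
  shows "\<exists>u\<in>spt p s (rips_class p s z). t \<le> qi_phi L \<epsilon> u"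
proof (cases "t \<le> qi_phi L \<epsilon> s")
  case True
  have "s \<in> spt p s (rips_class p s z)"
    using z by (simp add: mem_spt_class_iff)
  with True show ?thesis by blast
next
  case False
  define u where "u = (t - \<epsilon>) / L"
  have phi_u: "qi_phi L \<epsilon> u = t"
    using L by (simp add: u_def qi_phi_def)
  have "L * s \<le> L * u"
    using False phi_u by (simp add: qi_phi_def)
  then have "s \<le> u"
    using L by simp
  have "chain_pushforward f z \<notin> rips_boundaries p t"
    using t False by (simp add: mem_spt_class_iff)
  then have "z \<notin> rips_boundaries p u"
    using rips_boundaries_pushforward [of u f t z p] quasi_isometry_qi_phi [OF f L] phi_u by blast
  then have "u \<in> spt p s (rips_class p s z)"
    using \<open>s \<le> u\<close> by (simp add: mem_spt_class_iff)
  then show ?thesis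
    using phi_u by force
qed

text \<open>The image of a preimage of \<open>c\<close> at scale \<open>t\<close> is a preimage of \<open>f\<^sub>* c\<close> at scale \<open>\<phi>(t)\<close>.\<close>

lemma phi_below_spt_pushforward:
  fixes f :: "'a::metric_space \<Rightarrow> 'b::metric_space"
  assumes f: "quasi_isometry L \<epsilon> \<delta> f" and L: "1 \<le> L" and \<epsilon>: "0 \<le> \<epsilon>"
    and fz: "chain_pushforward f z \<notin> rips_boundaries p (qi_phi L \<epsilon> s)"
    and t: "t \<in> spt p s (rips_class p s z)"
  shows "\<exists>r\<in>spt p (qi_phi L \<epsilon> s) (rips_class p (qi_phi L \<epsilon> s) (chain_pushforward f z)).
           r \<le> qi_phi L \<epsilon> t"
proof (cases "s \<le> t")
  case True
  have "qi_phi L \<epsilon> s \<in> spt p (qi_phi L \<epsilon> s)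
          (rips_class p (qi_phi L \<epsilon> s) (chain_pushforward f z))"
    using fz by (simp add: mem_spt_class_iff)
  moreover have "qi_phi L \<epsilon> s \<le> qi_phi L \<epsilon> t"
    using True L by (simp add: qi_phi_def)
  ultimately show ?thesis by blast
next
  case False
  then obtain y where y: "y \<in> rips_cycles p t" "y + z \<in> rips_boundaries p s" and "0 \<le> t"
    using t by (auto simp: mem_spt_class_iff)
  have "chain_pushforward f y \<in> rips_cycles p (qi_phi L \<epsilon> t)"
    using rips_cycles_pushforward quasi_isometry_qi_phi [OF f L] y(1) by blast
  moreover have "chain_pushforward f y + chain_pushforward f z \<in> rips_boundaries p (qi_phi L \<epsilon> s)"
    using rips_boundaries_pushforward quasi_isometry_qi_phi [OF f L] y(2)
    by (metis chain_pushforward_add)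
  moreover have "0 \<le> qi_phi L \<epsilon> t" "qi_phi L \<epsilon> t \<le> qi_phi L \<epsilon> s"
    using False L \<epsilon> \<open>0 \<le> t\<close> by (auto simp: qi_phi_def)
  ultimately have "qi_phi L \<epsilon> t \<in> spt p (qi_phi L \<epsilon> s)
      (rips_class p (qi_phi L \<epsilon> s) (chain_pushforward f z))"
    by (auto simp: mem_spt_class_iff)
  then show ?thesis by blast
qed

text \<open>Here \<open>r = \<vartheta>'\<^sup>-\<^sup>1(t)\<close>, and \<open>r \<ge> \<phi>(s)\<close> because \<open>\<vartheta>'(\<phi>(s)) = \<lambda>'(s) \<le> t\<close>.  If \<open>f\<^sub>* z\<close> bounded at
  scale \<open>r\<close>, then \<open>g\<^sub>* f\<^sub>* z\<close>, which is homologous to \<open>z\<close> at scale \<open>\<lambda>'(s)\<close>, would bound at scale \<open>t\<close>.\<close>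

lemma pushforward_survives:
  fixes f :: "'a::metric_space \<Rightarrow> 'b::metric_space"
  assumes f: "quasi_isometry L \<epsilon> \<delta> f" and L: "1 \<le> L" and "0 \<le> \<epsilon>" and "0 \<le> \<delta>'"
    and g: "\<And>y. dist (f (g y)) y \<le> \<delta>'"
    and z: "z \<in> rips_cycles p s" "z \<notin> rips_boundaries p t"
    and t: "qi_lambda L \<epsilon> \<delta>' s \<le> t"
    and ps: "0 \<le> p" "0 \<le> s"
  shows "\<exists>r\<ge>qi_phi L \<epsilon> s. chain_pushforward f z \<notin> rips_boundaries p r \<and> t = qi_theta L \<epsilon> \<delta>' r"
proof -
  define r where "r = (t - L * (\<epsilon> + 2 * \<delta>')) / L"
  have theta_r: "qi_theta L \<epsilon> \<delta>' r = t"
    using L by (simp add: r_def qi_theta_def)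
  have "qi_theta L \<epsilon> \<delta>' (qi_phi L \<epsilon> s) \<le> qi_theta L \<epsilon> \<delta>' r"
    using t by (simp add: theta_r qi_theta_phi)
  then have "qi_phi L \<epsilon> s \<le> r"
    using L by (simp add: qi_theta_def)
  have "z + chain_pushforward g (chain_pushforward f z) \<in> rips_boundaries p t"
    using quasi_inverse_pushforward_homologous [OF f L assms(3,4) g ps z(1)] rips_boundaries_mono [OF t]
    by blast
  then have "chain_pushforward g (chain_pushforward f z) \<notin> rips_boundaries p t"
    using z(2) rips_boundaries_add_cancel by blast
  then have "chain_pushforward f z \<notin> rips_boundaries p r"
    using rips_boundaries_pushforward [of r g t] quasi_inverse_dist(1) [OF f L g] theta_r by blast
  then show ?thesis
    using theta_r \<open>qi_phi L \<epsilon> s \<le> r\<close> by blast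
qed

text \<open>If \<open>f\<^sub>* z\<close> is homologous to a cycle \<open>y\<close> of scale \<open>t\<close>, then \<open>z\<close> is homologous to \<open>g\<^sub>* y\<close> at scale
  \<open>\<lambda>'(s)\<close>; the cycle \<open>g\<^sub>* y\<close> has scale \<open>\<vartheta>'(t)\<close>.  For \<open>t \<ge> \<phi>(s)\<close> the scale \<open>\<lambda>'(s) = \<vartheta>'(\<phi>(s))\<close>, at
  which \<open>z\<close> is nonzero, already lies in the total support below \<open>\<vartheta>'(t)\<close>.\<close>

lemma total_spt_below_theta:
  fixes f :: "'a::metric_space \<Rightarrow> 'b::metric_space"
  assumes f: "quasi_isometry L \<epsilon> \<delta> f" and L: "1 \<le> L" and "0 \<le> \<epsilon>" and "0 \<le> \<delta>'"
    and g: "\<And>y. dist (f (g y)) y \<le> \<delta>'"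
    and z: "z \<in> rips_cycles p s" "z \<notin> rips_boundaries p (qi_lambda L \<epsilon> \<delta>' s)"
    and ps: "0 \<le> p" "0 \<le> s"
    and t: "t \<in> spt p (qi_phi L \<epsilon> s) (rips_class p (qi_phi L \<epsilon> s) (chain_pushforward f z))"
  shows "\<exists>u\<in>total_spt p s (rips_class p s z). u \<le> qi_theta L \<epsilon> \<delta>' t"
proof -
  let ?l = "qi_lambda L \<epsilon> \<delta>' s"
  have "s \<le> s + L * (\<epsilon> + \<delta>')"
    using assms by simp
  also have "\<dots> \<le> ?l"
    using assms by (intro qi_lambda_ge)
  finally have "s \<le> ?l" .
  have theta_mono: "qi_theta L \<epsilon> \<delta>' a \<le> qi_theta L \<epsilon> \<delta>' b" if "a \<le> b" for a b
    using that L by (simp add: qi_theta_def)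
  show ?thesis
  proof (cases "qi_phi L \<epsilon> s \<le> t")
    case True
    have "?l \<in> total_spt p s (rips_class p s z)"
      using z(2) \<open>s \<le> ?l\<close> by (auto intro!: mem_total_spt_classI [of s ?l] simp: mem_spt_class_iff)
    moreover have "?l \<le> qi_theta L \<epsilon> \<delta>' t"
      using theta_mono [OF True] by (simp add: qi_theta_phi)
    ultimately show ?thesis by blast
  next
    case False
    then obtain y where y: "y \<in> rips_cycles p t"
        "y + chain_pushforward f z \<in> rips_boundaries p (qi_phi L \<epsilon> s)" and "0 \<le> t"
      using t by (auto simp: mem_spt_class_iff)
    have gdist: "dist x x' \<le> a \<Longrightarrow> dist (g x) (g x') \<le> qi_theta L \<epsilon> \<delta>' a" for x x' a
      by (rule quasi_inverse_dist [OF f L g])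
    have gy: "chain_pushforward g y \<in> rips_cycles p (qi_theta L \<epsilon> \<delta>' t)"
      using rips_cycles_pushforward gdist y(1) by blast
    have "chain_pushforward g y + chain_pushforward g (chain_pushforward f z) \<in> rips_boundaries p ?l"
      using rips_boundaries_pushforward [of "qi_phi L \<epsilon> s" g ?l, OF _ y(2)]
        gdist [of _ _ "qi_phi L \<epsilon> s"]
      by (simp add: chain_pushforward_add qi_theta_phi)
    moreover have "z + chain_pushforward g (chain_pushforward f z) \<in> rips_boundaries p ?l"
      by (rule quasi_inverse_pushforward_homologous [OF f L assms(3,4) g ps z(1)])
    ultimately have "(chain_pushforward g y + chain_pushforward g (chain_pushforward f z))
        + (z + chain_pushforward g (chain_pushforward f z)) \<in> rips_boundaries p ?l"
      by (rule rips_boundaries_add)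
    then have "chain_pushforward g y + z \<in> rips_boundaries p ?l"
      by (simp add: ac_simps)
    moreover have "0 \<le> qi_theta L \<epsilon> \<delta>' t"
      using assms \<open>0 \<le> t\<close> by (simp add: qi_theta_def)
    moreover have "qi_theta L \<epsilon> \<delta>' t \<le> ?l"
      using theta_mono [of t "qi_phi L \<epsilon> s"] False by (simp add: qi_theta_phi)
    ultimately have "qi_theta L \<epsilon> \<delta>' t \<in> spt p ?l (rips_class p ?l z)"
      using gy by (auto simp: mem_spt_class_iff)
    then show ?thesis
      using z(2) \<open>s \<le> ?l\<close> mem_total_spt_classI by blast
  qed
qed

theorem theorem4p8:
  fixes f :: "'a::metric_space \<Rightarrow> 'b::metric_space"
    and L \<epsilon> \<delta> s :: real and p :: int
    and c :: "('a list \<Rightarrow>\<^sub>0 bit) set"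
  assumes "1 \<le> L" and "0 \<le> \<epsilon>" and "0 \<le> \<delta>"
    and "quasi_isometry L \<epsilon> \<delta> f"
    and "qi_stable L \<epsilon> \<delta> p s c"
  defines "d \<equiv> rips_pushforward L \<epsilon> p s f c"
    and "\<phi> \<equiv> extend_ereal (qi_phi L \<epsilon>)"
    and "\<theta>inv \<equiv> extend_ereal (inv_into UNIV (qi_theta L \<epsilon> \<delta>))"
  shows "d \<in> carrier (rips_homology p (qi_phi L \<epsilon> s)) \<and>
         d \<noteq> \<one>\<^bsub>rips_homology p (qi_phi L \<epsilon> s)\<^esub> \<and>
         sup_ereal (spt p (qi_phi L \<epsilon> s) d)
           \<in> {\<theta>inv (sup_ereal (spt p s c)) .. \<phi> (sup_ereal (spt p s c))} \<and>
         inf_ereal (spt p (qi_phi L \<epsilon> s) d)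
           \<in> {\<theta>inv (inf_ereal (total_spt p s c)) .. \<phi> (inf_ereal (spt p s c))}"
proof -
  obtain z where z: "z \<in> rips_cycles p s" and c: "c = rips_class p s z"
    using assms(5) by (auto simp: qi_stable_def carrier_rips_homology)
  have z_nonzero: "z \<notin> rips_boundaries p s"
    using assms(5) by (simp add: qi_stable_def c rips_class_eq_one_iff)
  have ps: "0 \<le> p" "0 \<le> s"
    using rips_nonboundary_nonneg [OF z z_nonzero] by auto
  obtain t0 where t0: "t0 \<in> spt p s c" "qi_lambda L \<epsilon> \<delta> s < t0"
    using assms(5) by (auto simp: qi_stable_def sup_ereal_def less_SUP_iff)
  have "0 \<le> L * (\<epsilon> + \<delta>)"
    using assms by simp
  then have lambda_ge: "s \<le> qi_lambda L \<epsilon> \<delta> s"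
    using qi_lambda_ge [of L \<epsilon> \<delta> s] assms(1-3) ps by linarith
  have alive: "z \<notin> rips_boundaries p t" if "t \<in> spt p s c" "qi_lambda L \<epsilon> \<delta> s < t" for t
    using that lambda_ge by (auto simp: c mem_spt_class_iff)
  have inverse: "\<exists>\<delta>' g. 0 \<le> \<delta>' \<and> (\<forall>y. dist (f (g y)) y \<le> \<delta>') \<and> qi_lambda L \<epsilon> \<delta>' s \<le> t \<and>
      (\<forall>u. qi_theta L \<epsilon> \<delta>' u \<le> qi_theta L \<epsilon> \<delta> u + \<eta>)"
    if "qi_lambda L \<epsilon> \<delta> s < t" and "0 < \<eta>" for t \<eta>
  proof -
    \<comment> \<open>Passing from \<open>\<delta>\<close> to \<open>\<delta>'\<close> raises both \<open>\<lambda>(s)\<close> and \<open>\<vartheta>\<close> by \<open>2 L (\<delta>' - \<delta>) = \<mu>\<close>.\<close>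
    define \<mu> where "\<mu> = min \<eta> (t - qi_lambda L \<epsilon> \<delta> s)"
    define \<delta>' where "\<delta>' = \<delta> + \<mu> / (2 * L)"
    have "0 < \<mu>"
      using that by (simp add: \<mu>_def)
    then have "\<delta> < \<delta>'"
      using assms(1) by (simp add: \<delta>'_def)
    then obtain g where g: "\<And>y. dist (f (g y)) y \<le> \<delta>'"
      using quasi_isometry_quasi_inverse [OF assms(4,3)] by blast
    have L\<delta>': "2 * L * \<delta>' = 2 * L * \<delta> + \<mu>"
      using assms(1) by (simp add: \<delta>'_def algebra_simps)
    have "qi_lambda L \<epsilon> \<delta>' s = qi_lambda L \<epsilon> \<delta> s + \<mu>"
      using L\<delta>' by (simp add: qi_lambda_def algebra_simps)
    moreover have "qi_theta L \<epsilon> \<delta>' u = qi_theta L \<epsilon> \<delta> u + \<mu>" for u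
      using L\<delta>' by (simp add: qi_theta_def algebra_simps)
    moreover have "\<mu> \<le> \<eta>" "\<mu> \<le> t - qi_lambda L \<epsilon> \<delta> s"
      by (auto simp: \<mu>_def)
    ultimately show ?thesis
      using g \<open>\<delta> < \<delta>'\<close> assms(3) by (intro exI [of _ \<delta>'] exI [of _ g]) auto
  qed
  let ?s = "qi_phi L \<epsilon> s"
  have d: "d = rips_class p ?s (chain_pushforward f z)"
    unfolding d_def rips_pushforward_def c
    by (rule rips_induced_class)
       (auto simp: chain_pushforward_add
             intro: rips_boundaries_pushforward quasi_isometry_qi_phi [OF assms(4,1)])
  have fz: "chain_pushforward f z \<in> rips_cycles p ?s"
    by (rule rips_cycles_pushforward [OF quasi_isometry_qi_phi [OF assms(4,1)] z])
  have survives: "\<exists>r\<ge>?s. chain_pushforward f z \<notin> rips_boundaries p r \<and> t \<le> qi_theta L \<epsilon> \<delta> r + \<eta>"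
    if t: "t \<in> spt p s c" and "0 < \<eta>" for t \<eta>
  proof -
    \<comment> \<open>Elements of the support up to \<open>\<lambda>(s)\<close> are dominated by \<open>t0\<close>.\<close>
    obtain t' where t': "t' \<in> spt p s c" "qi_lambda L \<epsilon> \<delta> s < t'" "t \<le> t'"
    proof (cases "qi_lambda L \<epsilon> \<delta> s < t")
      case True
      with t show thesis by (intro that) auto
    next
      case False
      with t0 show thesis by (intro that) auto
    qed
    obtain \<delta>' g where \<delta>': "0 \<le> \<delta>'" and g: "\<And>y. dist (f (g y)) y \<le> \<delta>'"
        and lambda: "qi_lambda L \<epsilon> \<delta>' s \<le> t'"
        and theta: "\<And>u. qi_theta L \<epsilon> \<delta>' u \<le> qi_theta L \<epsilon> \<delta> u + \<eta>"
      using inverse [OF t'(2) \<open>0 < \<eta>\<close>] by blast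
    obtain r where "?s \<le> r" "chain_pushforward f z \<notin> rips_boundaries p r" "t' = qi_theta L \<epsilon> \<delta>' r"
      using pushforward_survives [OF assms(4,1,2) \<delta>' g z alive [OF t'(1,2)] lambda ps] by blast
    then show ?thesis
      using theta [of r] t'(3) by force
  qed
  have inf_lower: "\<exists>u\<in>total_spt p s c. u \<le> qi_theta L \<epsilon> \<delta> t + \<eta>"
    if t: "t \<in> spt p ?s d" and "0 < \<eta>" for t \<eta>
  proof -
    obtain \<delta>' g where \<delta>': "0 \<le> \<delta>'" and g: "\<And>y. dist (f (g y)) y \<le> \<delta>'"
        and lambda: "qi_lambda L \<epsilon> \<delta>' s \<le> t0"
        and theta: "\<And>u. qi_theta L \<epsilon> \<delta>' u \<le> qi_theta L \<epsilon> \<delta> u + \<eta>"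
      using inverse [OF t0(2) \<open>0 < \<eta>\<close>] by blast
    have "z \<notin> rips_boundaries p (qi_lambda L \<epsilon> \<delta>' s)"
      using alive [OF t0] rips_boundaries_mono [OF lambda] by blast
    then have "\<exists>u\<in>total_spt p s c. u \<le> qi_theta L \<epsilon> \<delta>' t"
      unfolding c using t [unfolded d]
      by (rule total_spt_below_theta [OF assms(4,1,2) \<delta>' g z _ ps])
    then show ?thesis
      using theta by (meson order_trans)
  qed
  have fz_nonzero: "chain_pushforward f z \<notin> rips_boundaries p ?s"
    using survives [OF t0(1), of 1] rips_boundaries_mono [of ?s _ p] by fastforce
  have phi: "strict_mono (qi_phi L \<epsilon>)" "bij (qi_phi L \<epsilon>)"
    and theta: "strict_mono (qi_theta L \<epsilon> \<delta>)" "bij (qi_theta L \<epsilon> \<delta>)"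
    using affine_strict_mono_bij [of L] assms(1)
    unfolding qi_phi_def [abs_def] qi_theta_def [abs_def] by auto
  have sup_upper: "\<exists>u\<in>spt p s c. t \<le> qi_phi L \<epsilon> u + \<eta>" if "t \<in> spt p ?s d" "0 < \<eta>" for t \<eta>
    using spt_pushforward_below_phi [OF assms(4,1) z_nonzero] that
    unfolding c d by (meson add_increasing2 less_imp_le)
  have sup_lower: "\<exists>r\<in>spt p ?s d. t \<le> qi_theta L \<epsilon> \<delta> r + \<eta>" if "t \<in> spt p s c" "0 < \<eta>" for t \<eta>
    using survives [OF that] by (auto simp: d mem_spt_class_iff)
  have inf_upper: "\<exists>r\<in>spt p ?s d. r \<le> qi_phi L \<epsilon> t + \<eta>" if "t \<in> spt p s c" "0 < \<eta>" for t \<eta>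
    using phi_below_spt_pushforward [OF assms(4,1,2) fz_nonzero] that
    unfolding c d by (meson add_increasing2 less_imp_le)
  have "d \<in> carrier (rips_homology p ?s)" "d \<noteq> \<one>\<^bsub>rips_homology p ?s\<^esub>"
    using fz fz_nonzero by (auto simp: d carrier_rips_homology rips_class_eq_one_iff)
  moreover have "sup_ereal (spt p ?s d) \<le> \<phi> (sup_ereal (spt p s c))"
    unfolding \<phi>_def using sup_upper by (intro sup_ereal_le_extend strict_mono_mono phi)
  moreover have "\<theta>inv (sup_ereal (spt p s c)) \<le> sup_ereal (spt p ?s d)"
    unfolding \<theta>inv_def extend_ereal_inv_le_iff [OF theta]
    using sup_lower by (intro sup_ereal_le_extend strict_mono_mono theta)
  moreover have "inf_ereal (spt p ?s d) \<le> \<phi> (inf_ereal (spt p s c))"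
    unfolding \<phi>_def extend_ereal_inv_le_iff [OF phi, symmetric]
    using inf_upper by (intro inv_extend_inf_ereal_le phi)
  moreover have "\<theta>inv (inf_ereal (total_spt p s c)) \<le> inf_ereal (spt p ?s d)"
    unfolding \<theta>inv_def using inf_lower by (intro inv_extend_inf_ereal_le theta)
  ultimately show ?thesis
    by simp
qed

end
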